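(* Consider functions $f$ of a parameter $T\ge 0$ with values $f(T)\in\mathbb{R}^{\max}_+$, with the pointwise product and the addition $$(f_1+_wf_2)(T)=\sum_{\alpha\in\mathbb{Q}\cap[0,1]} w(\alpha,T)\,f_1(T)^\alpha f_2(T)^{1-\alpha},\qquad w(\alpha,T)=\alpha^{-T\alpha}(1-\alpha)^{-T(1-\alpha)},$$ and the one parameter group of automorphisms $\alpha_\lambda$, $\lambda\in\mathbb{R}_+^\times$, given by $\alpha_\lambda(f)(T)=f(T/\lambda)^\lambda$. The fixed points of $\alpha_\lambda$ (that is, the functions $f$ with $\alpha_\lambda(f)=f$ for all $\lambda>0$) are of the form $$f(T)=a^T,$$ and they form the semi-field $\mathbb{R}_+$ which is the positive part of the field $\mathbb{R}$ of real numbers, endowed with the ordinary addition.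
   Context: $\mathbb{R}^{\max}_+$ is the semi-field $[0,\infty)$ whose product is the ordinary one and whose addition is $\max$. The infinite sum defining $+_w$ is computed in $\mathbb{R}^{\max}_+$, i.e. it is the supremum of its terms. Conventions: $w(0,T)=w(1,T)=1$, and $x^\alpha y^{1-\alpha}$ means $x$ for $\alpha=1$ and $y$ for $\alpha=0$. Explicitly, $(f_1+_wf_2)(T)=\left(f_1(T)^{1/T}+f_2(T)^{1/T}\right)^T$ for $T>0$ (with ordinary addition of real numbers on the right), and $(f_1+_wf_2)(0)=\sup(f_1(0),f_2(0))$.
   Formalization: The form a^T and the semi-field claim are proved for functions continuous at T=0 (0^T is the zero function); for arbitrary functions they fail, e.g. f(0)=0, f(T)=1 for T>0 is fixed, and the fixed points are shown to be a^T for T>0 with f(0) equal to 0 or 1. *)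

theory Defs
  imports "HOL-Analysis.Analysis" "HOL-Algebra.QuotRing"
begin

text \<open>A semifield, in the style of the locale \<^locale>\<open>field\<close>, but over a semiring.\<close>

locale semifield = semiring R + comm_monoid R for R (structure) +
  assumes one_not_zero: "\<one> \<noteq> \<zero>"
    and semifield_Units: "Units R = carrier R - {\<zero>}"

definition nonneg_reals :: "real ring" where
  "nonneg_reals =
    \<lparr>carrier = {0..}, mult = (*), one = 1, zero = 0, add = (+)\<rparr>"

text \<open>The function type is total, so functions of \<open>T \<ge> 0\<close> are represented extensionally.\<close>

definition param_funs :: "(real \<Rightarrow> real) set" where
  "param_funs = ({0..} \<rightarrow>\<^sub>E {0..})"

text \<open>Invariance under the flow puts no link between the value at \<open>T = 0\<close> and the values at
  \<open>T > 0\<close>: the function \<open>f(0) = 0\<close>, \<open>f(T) = 1\<close> for \<open>T > 0\<close>, is invariant but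
  not of the form \<open>a\<^sup>T\<close>. The link is provided by continuity at \<open>T = 0\<close>.\<close>

definition param_funs_cont0 :: "(real \<Rightarrow> real) set" where
  "param_funs_cont0 = {f \<in> param_funs. continuous (at 0 within {0..}) f}"

text \<open>The cases at \<open>\<alpha> = 0\<close> and \<open>\<alpha> = 1\<close> in the next two definitions are needed because of
  \<open>0 powr 0 = 0\<close>.\<close>

definition weight :: "real \<Rightarrow> real \<Rightarrow> real" where
  "weight \<alpha> T =
    (if \<alpha> = 0 \<or> \<alpha> = 1 then 1
     else \<alpha> powr (- T * \<alpha>) * (1 - \<alpha>) powr (- T * (1 - \<alpha>)))"

definition geom_mean :: "real \<Rightarrow> real \<Rightarrow> real \<Rightarrow> real" where
  "geom_mean \<alpha> x y =
    (if \<alpha> = 1 then x else if \<alpha> = 0 then y else x powr \<alpha> * y powr (1 - \<alpha>))"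

text \<open>The infinite sum over the rationals in \<open>[0,1]\<close> is taken with respect to the addition
  \<open>max\<close>. The terms are bounded (by \<open>2\<^sup>T max (f\<^sub>1(T)) (f\<^sub>2(T))\<close>), so the real supremum is the
  genuine one.\<close>

definition plus_w :: "(real \<Rightarrow> real) \<Rightarrow> (real \<Rightarrow> real) \<Rightarrow> real \<Rightarrow> real" where
  "plus_w f\<^sub>1 f\<^sub>2 =
    (\<lambda>T\<in>{0..}. SUP \<alpha>\<in>\<rat> \<inter> {0..1}. weight \<alpha> T * geom_mean \<alpha> (f\<^sub>1 T) (f\<^sub>2 T))"

definition w_structure :: "(real \<Rightarrow> real) set \<Rightarrow> (real \<Rightarrow> real) ring" where
  "w_structure S =
    \<lparr>carrier = S, mult = (\<lambda>f g. \<lambda>T\<in>{0..}. f T * g T), one = (\<lambda>T\<in>{0..}. 1),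
     zero = (\<lambda>T\<in>{0..}. 0), add = plus_w\<rparr>"

definition flow :: "real \<Rightarrow> (real \<Rightarrow> real) \<Rightarrow> real \<Rightarrow> real" where
  "flow l f = (\<lambda>T\<in>{0..}. f (T / l) powr l)"

definition flow_fixed :: "(real \<Rightarrow> real) set \<Rightarrow> (real \<Rightarrow> real) set" where
  "flow_fixed S = {f \<in> S. \<forall>l>0. flow l f = f}"

text \<open>The function \<open>T \<mapsto> a\<^sup>T\<close>. For \<open>a = 0\<close> this is the zero function, also at \<open>T = 0\<close>,
  since \<open>0 powr 0 = 0\<close>; it is the zero element of the semifield.\<close>

definition power_fun :: "real \<Rightarrow> real \<Rightarrow> real" where
  "power_fun a = (\<lambda>T\<in>{0..}. a powr T)"

end

theory Submission
  imports Defs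
begin

text \<open>
  The weight \<open>w(\<alpha>, T)\<close> is the exponential of \<open>T\<close> times the entropy of
  \<open>(\<alpha>, 1 - \<alpha>)\<close>, and maximising entropy plus a linear function gives a logarithm of a sum of
  exponentials. Concretely, with \<open>u = x\<^sup>1\<^sup>/\<^sup>T\<close> and
  \<open>v = y\<^sup>1\<^sup>/\<^sup>T\<close>, the term of index \<open>\<alpha>\<close> of the sum is the \<open>T\<close>-th power of the weighted geometric mean
  of \<open>u / \<alpha>\<close> and \<open>v / (1 - \<alpha>)\<close>. The weighted inequality between geometric and arithmetic means
  bounds this mean by \<open>u + v\<close>, and the bound is attained at \<open>\<alpha> = u / (u + v)\<close>. That point may be irrational, but the
  terms are continuous in \<open>\<alpha>\<close>, so the supremum over the rationals is still
  \<open>(u + v)\<^sup>T\<close>. This is \<open>SUP_weighted_geom_mean\<close>.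

  At each \<open>T > 0\<close> the addition is thus the ordinary addition of reals transported along
  \<open>t \<mapsto> t\<^sup>T\<close>, and at \<open>T = 0\<close> it is the maximum. The semiring laws follow pointwise, and so does
  the additivity of the flow, which raises values to the power \<open>l\<close> while replacing the exponent
  \<open>T / l\<close> by \<open>T\<close>. Sums stay continuous at \<open>T = 0\<close> because the power sum lies between
  \<open>max x y\<close> and \<open>2\<^sup>T max x y\<close>.

  Invariance of \<open>f\<close> under the flow with \<open>l = T\<close> reads \<open>f(T) = f(1)\<^sup>T\<close>. At \<open>T = 0\<close> it only says
  that \<open>f(0)\<close> is idempotent; continuity then selects \<open>f(0) = 1\<close> if \<open>f(1) > 0\<close>, and
  \<open>f(0) = 0\<close> if \<open>f(1) = 0\<close>. On the functions \<open>T \<mapsto> a\<^sup>T\<close> the \<open>T\<close>-th root in the power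
  sum cancels, so that \<open>a \<mapsto> (T \<mapsto> a\<^sup>T)\<close> turns ordinary sums into \<open>w\<close>-sums.
\<close>

section \<open>The weighted supremum as a power sum\<close>

definition power_sum :: "real \<Rightarrow> real \<Rightarrow> real \<Rightarrow> real" where
  "power_sum T x y =
    (if T = 0 then max x y else (x powr (1 / T) + y powr (1 / T)) powr T)"

text \<open>The entropy factor \<open>\<alpha>\<^sup>-\<^sup>T\<^sup>\<alpha>\<close> is absorbed by dividing \<open>x\<^sup>1\<^sup>/\<^sup>T\<close> by \<open>\<alpha>\<close>, which brings the
  term into the form to which the inequality of means applies.\<close>

lemma weighted_geom_mean_eq_powr:
  assumes "T > 0" "0 < \<alpha>" "\<alpha> < 1"
  shows "weight \<alpha> T * geom_mean \<alpha> x y =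
    ((x powr (1 / T) / \<alpha>) powr \<alpha> * (y powr (1 / T) / (1 - \<alpha>)) powr (1 - \<alpha>)) powr T"
proof -
  have "p powr (- T * p) = 1 / (p powr p) powr T" for p
    by (simp add: powr_powr powr_minus_divide mult.commute)
  moreover have "z powr p = ((z powr (1 / T)) powr p) powr T" for z p
    using assms by (simp add: powr_powr)
  ultimately show ?thesis
    using assms by (simp add: weight_def geom_mean_def powr_mult powr_divide)
qed

text \<open>For \<open>0 < \<alpha> < 1\<close> and \<open>T > 0\<close> this is the weighted inequality of means. The other cases
  are elementary: at an endpoint the term is \<open>x\<close> or \<open>y\<close>, it vanishes at an interior \<open>\<alpha>\<close> if one
  of the arguments does, and at \<open>T = 0\<close> the weight is \<open>1\<close> and a geometric mean is at most the
  maximum.\<close>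

lemma weighted_geom_mean_le_power_sum:
  assumes T: "T \<ge> 0" and x: "x \<ge> 0" and y: "y \<ge> 0" and \<alpha>: "0 \<le> \<alpha>" "\<alpha> \<le> 1"
  shows "weight \<alpha> T * geom_mean \<alpha> x y \<le> power_sum T x y"
proof -
  consider "T = 0" | "T > 0" "\<alpha> = 0 \<or> \<alpha> = 1" | "T > 0" "0 < \<alpha>" "\<alpha> < 1" "x = 0 \<or> y = 0"
    | "T > 0" "0 < \<alpha>" "\<alpha> < 1" "x > 0" "y > 0"
    using assms by fastforce
  then show ?thesis
  proof cases
    case 1
    have "x powr \<alpha> * y powr (1 - \<alpha>) \<le> max x y powr \<alpha> * max x y powr (1 - \<alpha>)"
      using x y \<alpha> by (intro mult_mono powr_mono2) auto
    also have "\<dots> = max x y"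
      using x by (simp flip: powr_add)
    finally show ?thesis
      using 1 \<alpha> by (auto simp: power_sum_def weight_def geom_mean_def)
  next
    case 2
    have "x = (x powr (1 / T)) powr T" "y = (y powr (1 / T)) powr T"
      using 2 x y by (simp_all add: powr_powr)
    moreover have "(x powr (1 / T)) powr T \<le> power_sum T x y"
      "(y powr (1 / T)) powr T \<le> power_sum T x y"
      using 2 by (auto simp: power_sum_def intro!: powr_mono2)
    ultimately show ?thesis
      using 2 by (auto simp: weight_def geom_mean_def)
  next
    case 3
    then show ?thesis
      by (auto simp: power_sum_def geom_mean_def)
  next
    case 4
    let ?u = "x powr (1 / T)" and ?v = "y powr (1 / T)"
    have "(?u / \<alpha>) powr \<alpha> * (?v / (1 - \<alpha>)) powr (1 - \<alpha>)
        \<le> \<alpha> * (?u / \<alpha>) + (1 - \<alpha>) * (?v / (1 - \<alpha>))"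
      using 4 by (intro Youngs_inequality_0) auto
    also have "\<dots> = ?u + ?v"
      using 4 by simp
    finally show ?thesis
      using 4 by (auto simp: weighted_geom_mean_eq_powr power_sum_def intro!: powr_mono2)
  qed
qed

text \<open>The two numbers whose means are compared coincide exactly if \<open>\<alpha>\<close> is the proportion of
  \<open>u\<close> in \<open>u + v\<close>; there the bound is attained.\<close>

lemma weighted_geom_mean_at_proportion:
  assumes "T > 0" "x > 0" "y > 0"
  defines "\<alpha> \<equiv> x powr (1 / T) / (x powr (1 / T) + y powr (1 / T))"
  shows "0 < \<alpha>" "\<alpha> < 1" "weight \<alpha> T * geom_mean \<alpha> x y = power_sum T x y"
proof -
  let ?u = "x powr (1 / T)" and ?v = "y powr (1 / T)"
  have pos: "?u > 0" "?v > 0"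
    using assms by auto
  have fraction: "0 < u / (u + v) \<and> u / (u + v) < 1 \<and> 1 - u / (u + v) = v / (u + v)"
    if "u > 0" "v > 0" for u v :: real
    using that by (simp add: field_simps)
  from fraction[OF pos] show \<alpha>: "0 < \<alpha>" "\<alpha> < 1"
    by (auto simp: \<alpha>_def)
  have "?u / \<alpha> = ?u + ?v"
    using pos by (simp add: \<alpha>_def)
  moreover have "1 - \<alpha> = ?v / (?u + ?v)"
    using fraction[OF pos] by (simp add: \<alpha>_def)
  then have "?v / (1 - \<alpha>) = ?u + ?v"
    using pos by simp
  moreover have "(?u + ?v) powr \<alpha> * (?u + ?v) powr (1 - \<alpha>) = ?u + ?v"
    using pos by (simp flip: powr_add)
  ultimately show "weight \<alpha> T * geom_mean \<alpha> x y = power_sum T x y"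
    using \<alpha> assms(1) by (simp add: weighted_geom_mean_eq_powr power_sum_def)
qed

text \<open>Continuity and density bridge the gap between the maximiser, which is possibly irrational,
  and the rational indices of the sum.\<close>

lemma continuous_on_weighted_geom_mean:
  assumes "x > 0" "y > 0"
  shows "continuous_on {0<..<1} (\<lambda>\<alpha>. weight \<alpha> T * geom_mean \<alpha> x y)"
proof -
  have "continuous_on {0<..<1} (\<lambda>\<alpha>. \<alpha> powr (- T * \<alpha>) * (1 - \<alpha>) powr (- T * (1 - \<alpha>))
          * (x powr \<alpha> * y powr (1 - \<alpha>)))"
    using assms by (intro continuous_intros) auto
  then show ?thesis
    by (rule continuous_on_eq) (auto simp: weight_def geom_mean_def)
qed

lemma continuous_on_le_if_le_on_Rats:
  fixes f :: "real \<Rightarrow> real"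
  assumes cont: "continuous_on {a<..<b} f" and c: "a < c" "c < b"
    and le: "\<And>q. q \<in> \<rat> \<Longrightarrow> a < q \<Longrightarrow> q < b \<Longrightarrow> f q \<le> z"
  shows "f c \<le> z"
proof (rule ccontr)
  assume "\<not> f c \<le> z"
  have "open (f -` {z<..} \<inter> {a<..<b})"
    using cont by (simp add: continuous_on_open_vimage)
  moreover have "c \<in> f -` {z<..} \<inter> {a<..<b}"
    using c \<open>\<not> f c \<le> z\<close> by auto
  ultimately obtain e where e: "e > 0" "ball c e \<subseteq> f -` {z<..} \<inter> {a<..<b}"
    by (meson openE)
  obtain q where q: "q \<in> \<rat>" "c < q" "q < c + e"
    using Rats_dense_in_real[of c "c + e"] e by auto
  then have "q \<in> ball c e"
    by (auto simp: dist_real_def)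
  then show False
    using e le q by fastforce
qed

lemma SUP_weighted_geom_mean:
  assumes T: "T \<ge> 0" and x: "x \<ge> 0" and y: "y \<ge> 0"
  shows "(SUP \<alpha>\<in>\<rat> \<inter> {0..1}. weight \<alpha> T * geom_mean \<alpha> x y) = power_sum T x y"
proof (rule cSup_eq_non_empty)
  show "(\<lambda>\<alpha>. weight \<alpha> T * geom_mean \<alpha> x y) ` (\<rat> \<inter> {0..1}) \<noteq> {}"
    using Rats_0 by fastforce
next
  fix t assume "t \<in> (\<lambda>\<alpha>. weight \<alpha> T * geom_mean \<alpha> x y) ` (\<rat> \<inter> {0..1})"
  then show "t \<le> power_sum T x y"
    using assms by (auto intro: weighted_geom_mean_le_power_sum)
next
  fix z
  assume "\<And>t. t \<in> (\<lambda>\<alpha>. weight \<alpha> T * geom_mean \<alpha> x y) ` (\<rat> \<inter> {0..1}) \<Longrightarrow> t \<le> z"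
  then have le: "weight q T * geom_mean q x y \<le> z" if "q \<in> \<rat>" "0 \<le> q" "q \<le> 1" for q
    using that by auto
  have ends: "x \<le> z" "y \<le> z"
    using le[of 1] le[of 0] by (auto simp: weight_def geom_mean_def)
  show "power_sum T x y \<le> z"
  proof (cases "T = 0 \<or> x = 0 \<or> y = 0")
    case True
    then show ?thesis
      using ends x y by (auto simp: power_sum_def powr_powr)
  next
    case False
    \<comment> \<open>An upper bound of the terms at rational indices also bounds the term at the maximiser.\<close>
    then have pos: "T > 0" "x > 0" "y > 0"
      using assms by auto
    note opt = weighted_geom_mean_at_proportion[OF pos]
    show ?thesis
      using continuous_on_le_if_le_on_Rats[OF continuous_on_weighted_geom_mean opt(1,2), of x y T z]
        le opt(3) pos by auto
  qed
qed

section \<open>Algebra of the power sum\<close>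

lemma power_sum_nonneg: "x \<ge> 0 \<Longrightarrow> power_sum T x y \<ge> 0"
  by (auto simp: power_sum_def)

lemma power_sum_commute: "power_sum T x y = power_sum T y x"
  by (auto simp: power_sum_def add.commute)

lemma power_sum_assoc:
  "power_sum T (power_sum T x y) z = power_sum T x (power_sum T y z)"
  by (auto simp: power_sum_def powr_powr add.assoc max.assoc)

lemma power_sum_0_left: "y \<ge> 0 \<Longrightarrow> power_sum T 0 y = y"
  by (auto simp: power_sum_def powr_powr)

lemma mult_power_sum:
  assumes "z \<ge> 0"
  shows "z * power_sum T x y = power_sum T (z * x) (z * y)"
proof (cases "T = 0")
  case True
  then show ?thesis
    using assms by (simp add: power_sum_def max_mult_distrib_left)
next
  case False
  have "power_sum T (z * x) (z * y) = (z powr (1 / T) * (x powr (1 / T) + y powr (1 / T))) powr T"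
    using False by (simp add: power_sum_def powr_mult distrib_left)
  also have "\<dots> = z * power_sum T x y"
    using False assms by (simp add: power_sum_def powr_mult powr_powr)
  finally show ?thesis ..
qed

lemma power_sum_mult: "z \<ge> 0 \<Longrightarrow> power_sum T x y * z = power_sum T (x * z) (y * z)"
  using mult_power_sum[of z T x y] by (simp add: mult.commute)

text \<open>Compatibility with the flow: the roots of order \<open>T / l\<close> of \<open>x\<close> and of order \<open>T\<close> of
  \<open>x\<^sup>l\<close> are the same number.\<close>

lemma power_sum_powr:
  assumes "l > 0" "x \<ge> 0" "y \<ge> 0"
  shows "power_sum (T / l) x y powr l = power_sum T (x powr l) (y powr l)"
proof (cases "T = 0")
  case True
  then show ?thesis
    using assms by (auto simp: power_sum_def max_def powr_less_cancel_iff powr_mono2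
        intro: antisym powr_mono2)
next
  case False
  then show ?thesis
    using assms by (simp add: power_sum_def powr_powr)
qed

text \<open>The following two bounds pinch the power sum to the maximum as \<open>T\<close> tends to \<open>0\<close>.
  The lower bound holds because \<open>x\<close> and \<open>y\<close> are themselves terms of the supremum.\<close>

lemma max_le_power_sum:
  assumes "T \<ge> 0" "x \<ge> 0" "y \<ge> 0"
  shows "max x y \<le> power_sum T x y"
  using weighted_geom_mean_le_power_sum[OF assms, of 0]
    weighted_geom_mean_le_power_sum[OF assms, of 1]
  by (simp add: weight_def geom_mean_def)

lemma power_sum_le_max:
  assumes "T \<ge> 0" "x \<ge> 0" "y \<ge> 0"
  shows "power_sum T x y \<le> 2 powr T * max x y"
proof (cases "T = 0")
  case True
  then show ?thesis by (simp add: power_sum_def)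
next
  case False
  have "x powr (1 / T) \<le> max x y powr (1 / T)" "y powr (1 / T) \<le> max x y powr (1 / T)"
    using assms by (auto intro: powr_mono2)
  then have "x powr (1 / T) + y powr (1 / T) \<le> 2 * max x y powr (1 / T)"
    by linarith
  then have "power_sum T x y \<le> (2 * max x y powr (1 / T)) powr T"
    using False assms by (simp add: power_sum_def powr_mono2)
  also have "\<dots> = 2 powr T * (max x y powr (1 / T)) powr T"
    by (rule powr_mult)
  also have "(max x y powr (1 / T)) powr T = max x y"
    using False assms by (subst powr_powr) simp
  finally show ?thesis .
qed

section \<open>The semirings of functions\<close>

lemma param_funs_nonneg: "f \<in> param_funs \<Longrightarrow> T \<ge> 0 \<Longrightarrow> f T \<ge> 0"
  by (auto simp: param_funs_def)

lemma param_funs_eqI: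
  assumes "f \<in> param_funs" "g \<in> param_funs" "\<And>T. T \<ge> 0 \<Longrightarrow> f T = g T"
  shows "f = g"
  using assms by (auto simp: param_funs_def intro: PiE_ext)

lemma restrict_in_param_funs:
  "(\<And>T. T \<ge> 0 \<Longrightarrow> h T \<ge> 0) \<Longrightarrow> (\<lambda>T\<in>{0..}. h T) \<in> param_funs"
  by (auto simp: param_funs_def)

lemma plus_w_apply:
  assumes "f \<in> param_funs" "g \<in> param_funs" "T \<ge> 0"
  shows "plus_w f g T = power_sum T (f T) (g T)"
  using assms by (simp add: plus_w_def SUP_weighted_geom_mean param_funs_nonneg)

lemma plus_w_in_param_funs:
  assumes "f \<in> param_funs" "g \<in> param_funs"
  shows "plus_w f g \<in> param_funs"
proof -
  have "plus_w f g = (\<lambda>T\<in>{0..}. power_sum T (f T) (g T))"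
    using assms by (auto simp: fun_eq_iff plus_w_apply) (simp add: plus_w_def)
  then show ?thesis
    using assms by (simp add: restrict_in_param_funs power_sum_nonneg param_funs_nonneg)
qed

lemma mult_in_param_funs:
  assumes "f \<in> param_funs" "g \<in> param_funs"
  shows "(\<lambda>T\<in>{0..}. f T * g T) \<in> param_funs"
  using assms by (simp add: restrict_in_param_funs param_funs_nonneg)

text \<open>The semiring laws are pointwise identities, so they hold on every set that is closed under
  the operations. This is used for all functions, for those continuous at \<open>0\<close>, and for the
  functions \<open>T \<mapsto> a\<^sup>T\<close>.\<close>

locale w_subsemiring =
  fixes S :: "(real \<Rightarrow> real) set"
  assumes sub: "S \<subseteq> param_funs"
    and zero: "(\<lambda>T\<in>{0..}. 0) \<in> S"
    and one: "(\<lambda>T\<in>{0..}. 1) \<in> S"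
    and mult: "f \<in> S \<Longrightarrow> g \<in> S \<Longrightarrow> (\<lambda>T\<in>{0..}. f T * g T) \<in> S"
    and plus: "f \<in> S \<Longrightarrow> g \<in> S \<Longrightarrow> plus_w f g \<in> S"
begin

lemma in_param_funs: "f \<in> S \<Longrightarrow> f \<in> param_funs"
  using sub by auto

lemma semiring_w_structure: "semiring (w_structure S)"
proof (intro semiring.intro semiring_axioms.intro abelian_monoidI monoidI)
  fix f assume "f \<in> carrier (w_structure S)"
  then have f: "f \<in> S" by (simp add: w_structure_def)
  note [simp] = in_param_funs plus_w_apply mult plus zero one
  show "\<one>\<^bsub>w_structure S\<^esub> \<otimes>\<^bsub>w_structure S\<^esub> f = f"
    "f \<otimes>\<^bsub>w_structure S\<^esub> \<one>\<^bsub>w_structure S\<^esub> = f"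
    "\<zero>\<^bsub>w_structure S\<^esub> \<oplus>\<^bsub>w_structure S\<^esub> f = f"
    "\<zero>\<^bsub>w_structure S\<^esub> \<otimes>\<^bsub>w_structure S\<^esub> f = \<zero>\<^bsub>w_structure S\<^esub>"
    "f \<otimes>\<^bsub>w_structure S\<^esub> \<zero>\<^bsub>w_structure S\<^esub> = \<zero>\<^bsub>w_structure S\<^esub>"
    using f by (auto simp: w_structure_def power_sum_0_left param_funs_nonneg
        restrict_in_param_funs intro!: param_funs_eqI)
  fix g assume "g \<in> carrier (w_structure S)"
  then have g: "g \<in> S" by (simp add: w_structure_def)
  show "f \<oplus>\<^bsub>w_structure S\<^esub> g = g \<oplus>\<^bsub>w_structure S\<^esub> f"
    using f g by (auto simp: w_structure_def intro!: param_funs_eqI power_sum_commute)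
  fix h assume "h \<in> carrier (w_structure S)"
  then have h: "h \<in> S" by (simp add: w_structure_def)
  show "f \<oplus>\<^bsub>w_structure S\<^esub> g \<oplus>\<^bsub>w_structure S\<^esub> h
      = f \<oplus>\<^bsub>w_structure S\<^esub> (g \<oplus>\<^bsub>w_structure S\<^esub> h)"
    "f \<otimes>\<^bsub>w_structure S\<^esub> g \<otimes>\<^bsub>w_structure S\<^esub> h
      = f \<otimes>\<^bsub>w_structure S\<^esub> (g \<otimes>\<^bsub>w_structure S\<^esub> h)"
    using f g h by (auto simp: w_structure_def power_sum_assoc param_funs_nonneg
        restrict_in_param_funs intro!: param_funs_eqI)
  show "h \<otimes>\<^bsub>w_structure S\<^esub> (f \<oplus>\<^bsub>w_structure S\<^esub> g)
      = h \<otimes>\<^bsub>w_structure S\<^esub> f \<oplus>\<^bsub>w_structure S\<^esub> h \<otimes>\<^bsub>w_structure S\<^esub> g"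
    "(f \<oplus>\<^bsub>w_structure S\<^esub> g) \<otimes>\<^bsub>w_structure S\<^esub> h
      = f \<otimes>\<^bsub>w_structure S\<^esub> h \<oplus>\<^bsub>w_structure S\<^esub> g \<otimes>\<^bsub>w_structure S\<^esub> h"
    using f g h
    by (auto simp: w_structure_def mult_power_sum power_sum_mult param_funs_nonneg
        intro!: param_funs_eqI)
qed (auto simp: w_structure_def mult plus zero one)

end

lemma w_subsemiring_param_funs: "w_subsemiring param_funs"
  by unfold_locales (auto simp: restrict_in_param_funs mult_in_param_funs plus_w_in_param_funs)

lemma param_funs_cont0_iff:
  "f \<in> param_funs_cont0 \<longleftrightarrow> f \<in> param_funs \<and> (f \<longlongrightarrow> f 0) (at 0 within {0..})"
  by (simp add: param_funs_cont0_def continuous_within)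

lemma eventually_at_0_nonneg: "\<forall>\<^sub>F T in at 0 within {0..}. (0::real) \<le> T"
  by (simp add: eventually_at_filter)

text \<open>The limit is computed for a formula \<open>h\<close>, which spares reasoning about the restriction to
  \<open>{0..}\<close> in each application.\<close>

lemma param_funs_cont0I:
  assumes "f \<in> param_funs" "\<And>T. T \<ge> 0 \<Longrightarrow> h T = f T" "(h \<longlongrightarrow> f 0) (at 0 within {0..})"
  shows "f \<in> param_funs_cont0"
proof -
  have "\<forall>\<^sub>F T in at 0 within {0..}. h T = f T"
    using eventually_at_0_nonneg by eventually_elim (use assms(2) in auto)
  then show ?thesis
    using assms by (auto simp: param_funs_cont0_iff intro: Lim_transform_eventually)
qed

lemma plus_w_in_param_funs_cont0:
  assumes "f \<in> param_funs_cont0" "g \<in> param_funs_cont0"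
  shows "plus_w f g \<in> param_funs_cont0"
proof -
  note nonneg = eventually_at_0_nonneg
  have f: "f \<in> param_funs" "(f \<longlongrightarrow> f 0) (at 0 within {0..})"
    and g: "g \<in> param_funs" "(g \<longlongrightarrow> g 0) (at 0 within {0..})"
    using assms by (auto simp: param_funs_cont0_iff)
  have lim: "((\<lambda>T. max (f T) (g T)) \<longlongrightarrow> max (f 0) (g 0)) (at 0 within {0..})"
    using f g by (intro tendsto_max)
  have "((\<lambda>T. 2 powr T * max (f T) (g T)) \<longlongrightarrow> 2 powr 0 * max (f 0) (g 0)) (at 0 within {0..})"
    by (intro tendsto_intros lim) auto
  then have lim2: "((\<lambda>T. 2 powr T * max (f T) (g T)) \<longlongrightarrow> max (f 0) (g 0)) (at 0 within {0..})"
    by simp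
  have "(plus_w f g \<longlongrightarrow> max (f 0) (g 0)) (at 0 within {0..})"
  proof (rule tendsto_sandwich[OF _ _ lim lim2])
    show "\<forall>\<^sub>F T in at 0 within {0..}. max (f T) (g T) \<le> plus_w f g T"
      using nonneg
      by eventually_elim (use f g max_le_power_sum in \<open>auto simp: plus_w_apply param_funs_nonneg\<close>)
    show "\<forall>\<^sub>F T in at 0 within {0..}. plus_w f g T \<le> 2 powr T * max (f T) (g T)"
      using nonneg
      by eventually_elim (use f g power_sum_le_max in \<open>auto simp: plus_w_apply param_funs_nonneg\<close>)
  qed
  then show ?thesis
    using f g by (simp add: param_funs_cont0_iff plus_w_in_param_funs plus_w_apply power_sum_def)
qed

lemma w_subsemiring_param_funs_cont0: "w_subsemiring param_funs_cont0"
proof unfold_locales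
  show "param_funs_cont0 \<subseteq> param_funs"
    by (auto simp: param_funs_cont0_def)
  show "(\<lambda>T\<in>{0..}. 0) \<in> param_funs_cont0"
    by (rule param_funs_cont0I[where h = "\<lambda>_. 0"]) (auto simp: restrict_in_param_funs)
  show "(\<lambda>T\<in>{0..}. 1) \<in> param_funs_cont0"
    by (rule param_funs_cont0I[where h = "\<lambda>_. 1"]) (auto simp: restrict_in_param_funs)
  show "(\<lambda>T\<in>{0..}. f T * g T) \<in> param_funs_cont0"
    if "f \<in> param_funs_cont0" "g \<in> param_funs_cont0" for f g
  proof (rule param_funs_cont0I[where h = "\<lambda>T. f T * g T"])
    show "((\<lambda>T. f T * g T) \<longlongrightarrow> (\<lambda>T\<in>{0..}. f T * g T) 0) (at 0 within {0..})"
      using that tendsto_mult[of f "f 0" _ g "g 0"] by (simp add: param_funs_cont0_iff)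
    show "(\<lambda>T\<in>{0..}. f T * g T) \<in> param_funs"
      using that by (intro mult_in_param_funs) (auto simp: param_funs_cont0_iff)
  qed simp
qed (rule plus_w_in_param_funs_cont0)

section \<open>The flow\<close>

lemma flow_in_param_funs: "flow l f \<in> param_funs"
  by (auto simp: flow_def restrict_in_param_funs)

lemma flow_apply: "T \<ge> 0 \<Longrightarrow> flow l f T = f (T / l) powr l"
  by (simp add: flow_def)

lemma flow_1: "f \<in> param_funs \<Longrightarrow> flow 1 f = f"
  by (rule param_funs_eqI) (auto simp: flow_in_param_funs flow_apply param_funs_nonneg)

lemma flow_mult:
  assumes "l > 0"
  shows "flow (l * m) f = flow l (flow m f)"
  using assms
  by (intro param_funs_eqI)
    (auto simp: flow_in_param_funs flow_apply powr_powr divide_divide_eq_left mult.commute)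

lemma flow_in_param_funs_cont0:
  assumes "f \<in> param_funs_cont0" "l > 0"
  shows "flow l f \<in> param_funs_cont0"
proof (rule param_funs_cont0I[where h = "\<lambda>T. f (T / l) powr l"])
  have f: "f \<in> param_funs" "(f \<longlongrightarrow> f 0) (at 0 within {0..})"
    using assms by (auto simp: param_funs_cont0_iff)
  have "((\<lambda>T. T / l) \<longlongrightarrow> 0 / l) (at 0 within {0..})"
    using assms by (intro tendsto_intros) auto
  then have "filterlim (\<lambda>T. T / l) (at 0 within {0..}) (at 0 within {0..})"
    using assms by (auto simp: filterlim_at eventually_at_filter)
  then have "((\<lambda>T. f (T / l)) \<longlongrightarrow> f 0) (at 0 within {0..})"
    by (rule filterlim_compose[OF f(2)])
  moreover have "\<forall>\<^sub>F T in at 0 within {0..}. 0 \<le> f (T / l)"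
    using eventually_at_0_nonneg by eventually_elim (use f assms in \<open>simp add: param_funs_nonneg\<close>)
  ultimately show "((\<lambda>T. f (T / l) powr l) \<longlongrightarrow> flow l f 0) (at 0 within {0..})"
    using assms by (auto simp: flow_apply intro!: tendsto_powr')
qed (auto simp: flow_in_param_funs flow_apply)

text \<open>The flow of parameter \<open>1 / l\<close> inverts the flow of parameter \<open>l\<close>; hence the set must be
  closed under the whole flow, not only under the flow of parameter \<open>l\<close>.\<close>

lemma (in w_subsemiring) flow_ring_iso:
  assumes l: "l > 0" and closed: "\<And>m f. m > 0 \<Longrightarrow> f \<in> S \<Longrightarrow> flow m f \<in> S"
  shows "flow l \<in> ring_iso (w_structure S) (w_structure S)"
proof -
  have inverse: "flow (1 / l) (flow l f) = f" "flow l (flow (1 / l) f) = f" if "f \<in> S" for f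
    using that l flow_mult[of "1 / l" l f] flow_mult[of l "1 / l" f]
    by (simp_all add: flow_1 in_param_funs)
  have bij: "bij_betw (flow l) S S"
    by (rule bij_betw_byWitness[where f' = "flow (1 / l)"]) (use l closed inverse in auto)
  have flow_prod: "flow l (\<lambda>T\<in>{0..}. f T * g T) = (\<lambda>T\<in>{0..}. flow l f T * flow l g T)"
    for f g
    using l by (auto simp: flow_def powr_mult)
  have flow_plus: "flow l (plus_w f g) = plus_w (flow l f) (flow l g)"
    if "f \<in> param_funs" "g \<in> param_funs" for f g
  proof (rule param_funs_eqI)
    fix T :: real assume "T \<ge> 0"
    then show "flow l (plus_w f g) T = plus_w (flow l f) (flow l g) T"
      using that l by (simp add: flow_in_param_funs flow_apply plus_w_apply power_sum_powr
          param_funs_nonneg)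
  qed (simp_all add: flow_in_param_funs plus_w_in_param_funs)
  have flow_one: "flow l (\<lambda>T\<in>{0..}. 1) = (\<lambda>T\<in>{0..}. 1)"
    using l by (auto simp: flow_def)
  have "flow l \<in> ring_hom (w_structure S) (w_structure S)"
    by (rule ring_hom_memI)
      (use l closed in \<open>simp_all add: w_structure_def flow_prod flow_plus flow_one in_param_funs\<close>)
  with bij show ?thesis
    by (simp add: ring_iso_def w_structure_def)
qed

section \<open>Fixed points\<close>

lemma flow_fixed_iff:
  assumes f: "f \<in> param_funs"
  shows "f \<in> flow_fixed param_funs \<longleftrightarrow>
    f 0 \<in> {0, 1} \<and> (\<exists>a\<ge>0. \<forall>T>0. f T = a powr T)"
proof
  assume "f \<in> flow_fixed param_funs"
  then have fixed: "f T = f (T / l) powr l" if "l > 0" "T \<ge> 0" for l T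
    using that flow_apply[of T l f] by (auto simp: flow_fixed_def)
  \<comment> \<open>The parameter \<open>l = 2\<close> already forces \<open>f 0\<close> to be idempotent.\<close>
  have "f 0 = f 0 * f 0"
    using fixed[of 2 0] f by (simp add: param_funs_nonneg power2_eq_square)
  then have "f 0 \<in> {0, 1}"
    by simp
  moreover have "\<forall>T>0. f T = f 1 powr T"
  proof (intro allI impI)
    fix T :: real assume "T > 0"
    then show "f T = f 1 powr T"
      using fixed[of T T] by simp
  qed
  moreover have "f 1 \<ge> 0"
    using f by (simp add: param_funs_nonneg)
  ultimately show "f 0 \<in> {0, 1} \<and> (\<exists>a\<ge>0. \<forall>T>0. f T = a powr T)"
    by blast
next
  assume "f 0 \<in> {0, 1} \<and> (\<exists>a\<ge>0. \<forall>T>0. f T = a powr T)"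
  then obtain a where f0: "f 0 \<in> {0, 1}" and a: "\<And>T. T > 0 \<Longrightarrow> f T = a powr T"
    by auto
  have "flow l f T = f T" if "l > 0" "T \<ge> 0" for l T
    using that f0 by (cases "T = 0") (auto simp: flow_apply a powr_powr)
  then show "f \<in> flow_fixed param_funs"
    using f by (auto simp: flow_fixed_def flow_in_param_funs intro!: param_funs_eqI)
qed

lemma power_fun_in_param_funs: "power_fun a \<in> param_funs"
  by (simp add: power_fun_def restrict_in_param_funs)

lemma power_fun_apply: "T \<ge> 0 \<Longrightarrow> power_fun a T = a powr T"
  by (simp add: power_fun_def)

text \<open>This includes \<open>a = 0\<close>: since \<open>0 powr 0 = 0\<close>, the function is then constantly \<open>0\<close>.\<close>

lemma tendsto_powr_at_0:
  "((\<lambda>T. a powr T) \<longlongrightarrow> a powr 0) (at 0 within {0..})" for a :: real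
  by (cases "a = 0") (auto intro!: tendsto_eq_intros)

lemma power_fun_in_param_funs_cont0: "power_fun a \<in> param_funs_cont0"
  by (rule param_funs_cont0I[where h = "\<lambda>T. a powr T"])
    (use tendsto_powr_at_0 in \<open>auto simp: power_fun_in_param_funs power_fun_apply\<close>)

text \<open>Away from \<open>0\<close> a fixed function is \<open>T \<mapsto> a\<^sup>T\<close>. Both sides being continuous at \<open>0\<close>, they
  agree there too.\<close>

lemma flow_fixed_cont0_eq: "flow_fixed param_funs_cont0 = power_fun ` {0..}"
proof (intro equalityI subsetI)
  fix f assume "f \<in> flow_fixed param_funs_cont0"
  then have f: "f \<in> param_funs" "(f \<longlongrightarrow> f 0) (at 0 within {0..})" "f \<in> flow_fixed param_funs"
    by (auto simp: flow_fixed_def param_funs_cont0_iff)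
  then obtain a where a: "a \<ge> 0" "\<And>T. T > 0 \<Longrightarrow> f T = a powr T"
    by (auto simp: flow_fixed_iff)
  have "\<forall>\<^sub>F T in at 0 within {0..}. a powr T = f T"
    using a by (auto simp: eventually_at_filter)
  then have "(f \<longlongrightarrow> a powr 0) (at 0 within {0..})"
    by (rule Lim_transform_eventually[OF tendsto_powr_at_0])
  moreover have "at 0 within {0..} \<noteq> (bot :: real filter)"
    by (simp add: at_within_Ici_at_right)
  ultimately have "f 0 = a powr 0"
    using f tendsto_unique by blast
  then have "f T = power_fun a T" if "T \<ge> 0" for T
    using a that by (cases "T = 0") (auto simp: power_fun_apply)
  then have "f = power_fun a"
    using f power_fun_in_param_funs by (intro param_funs_eqI)
  then show "f \<in> power_fun ` {0..}"
    using a by auto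
next
  fix f assume "f \<in> power_fun ` {0..}"
  then obtain a where a: "a \<ge> 0" "f = power_fun a"
    by auto
  then have "f \<in> flow_fixed param_funs"
    using flow_fixed_iff[of f] by (auto simp: power_fun_in_param_funs power_fun_apply)
  then show "f \<in> flow_fixed param_funs_cont0"
    using a power_fun_in_param_funs_cont0 by (auto simp: flow_fixed_def)
qed

lemma power_fun_0: "power_fun 0 = (\<lambda>T\<in>{0..}. 0)"
  by (simp add: power_fun_def)

lemma power_fun_1: "power_fun 1 = (\<lambda>T\<in>{0..}. 1)"
  by (simp add: power_fun_def)

lemma power_fun_mult: "power_fun (a * b) = (\<lambda>T\<in>{0..}. power_fun a T * power_fun b T)"
  by (auto simp: power_fun_def powr_mult)

lemma power_fun_add:
  assumes "a \<ge> 0" "b \<ge> 0"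
  shows "power_fun (a + b) = plus_w (power_fun a) (power_fun b)"
  using assms
  by (intro param_funs_eqI)
    (auto simp: power_fun_in_param_funs plus_w_in_param_funs plus_w_apply power_fun_apply
      power_sum_def powr_powr)

text \<open>The base is the value at \<open>T = 1\<close>.\<close>

lemma inj_on_power_fun: "inj_on power_fun {0..}"
proof (rule inj_onI)
  fix a b :: real assume ab: "a \<in> {0..}" "b \<in> {0..}" and "power_fun a = power_fun b"
  then have "power_fun a 1 = power_fun b 1"
    by simp
  then show "a = b"
    using ab by (simp add: power_fun_apply)
qed

lemma w_subsemiring_power_fun: "w_subsemiring (power_fun ` {0..})"
proof
  show "power_fun ` {0..} \<subseteq> param_funs"
    by (auto simp: power_fun_in_param_funs)
  show "(\<lambda>T\<in>{0..}. 0) \<in> power_fun ` {0..}" "(\<lambda>T\<in>{0..}. 1) \<in> power_fun ` {0..}"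
    by (auto simp flip: power_fun_0 power_fun_1)
  fix f g assume "f \<in> power_fun ` {0..}" "g \<in> power_fun ` {0..}"
  then obtain a b where ab: "a \<ge> 0" "b \<ge> 0" "f = power_fun a" "g = power_fun b"
    by auto
  show "(\<lambda>T\<in>{0..}. f T * g T) \<in> power_fun ` {0..}"
    by (rule image_eqI[where x = "a * b"]) (use ab in \<open>simp_all add: power_fun_mult\<close>)
  show "plus_w f g \<in> power_fun ` {0..}"
    by (rule image_eqI[where x = "a + b"]) (use ab in \<open>simp_all add: power_fun_add\<close>)
qed

lemma power_fun_ring_iso: "power_fun \<in> ring_iso nonneg_reals (w_structure (power_fun ` {0..}))"
proof -
  have "power_fun \<in> ring_hom nonneg_reals (w_structure (power_fun ` {0..}))"
    by (rule ring_hom_memI)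
      (simp_all add: nonneg_reals_def w_structure_def power_fun_mult power_fun_add power_fun_1)
  moreover have "bij_betw power_fun {0..} (power_fun ` {0..})"
    by (rule inj_on_imp_bij_betw[OF inj_on_power_fun])
  ultimately show ?thesis
    by (simp add: ring_iso_def nonneg_reals_def w_structure_def)
qed

text \<open>Products of functions \<open>T \<mapsto> a\<^sup>T\<close> correspond to products of their bases, so invertibility
  is that of nonnegative reals.\<close>

lemma semifield_power_fun: "semifield (w_structure (power_fun ` {0..}))"
proof -
  interpret w_subsemiring "power_fun ` {0..}"
    by (rule w_subsemiring_power_fun)
  interpret semiring "w_structure (power_fun ` {0..})"
    by (rule semiring_w_structure)
  have prod: "power_fun a \<otimes>\<^bsub>w_structure (power_fun ` {0..})\<^esub> power_fun b = power_fun (a * b)" for a b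
    by (simp add: w_structure_def power_fun_mult)
  have one: "\<one>\<^bsub>w_structure (power_fun ` {0..})\<^esub> = power_fun 1"
    by (simp add: w_structure_def power_fun_1)
  have zero: "\<zero>\<^bsub>w_structure (power_fun ` {0..})\<^esub> = power_fun 0"
    by (simp add: w_structure_def power_fun_0)
  have carrier: "carrier (w_structure (power_fun ` {0..})) = power_fun ` {0..}"
    by (simp add: w_structure_def)
  have eq_iff: "power_fun a = power_fun b \<longleftrightarrow> a = b" if "a \<ge> 0" "b \<ge> 0" for a b
    using that inj_on_eq_iff[OF inj_on_power_fun, of a b] by simp
  have unit: "power_fun a \<in> Units (w_structure (power_fun ` {0..})) \<longleftrightarrow> a \<noteq> 0" if "a \<ge> 0" for a
  proof -
    have "power_fun a \<in> Units (w_structure (power_fun ` {0..})) \<longleftrightarrow> (\<exists>b\<ge>0. b * a = 1)"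
      using that by (auto simp: Units_def carrier one prod eq_iff mult.commute)
    also have "\<dots> \<longleftrightarrow> a \<noteq> 0"
      using that by (auto intro!: exI[of _ "1 / a"])
    finally show ?thesis .
  qed
  show ?thesis
  proof (intro semifield.intro semifield_axioms.intro semiring_axioms monoid_comm_monoidI)
    show "\<one>\<^bsub>w_structure (power_fun ` {0..})\<^esub> \<noteq> \<zero>\<^bsub>w_structure (power_fun ` {0..})\<^esub>"
      by (simp add: one zero eq_iff)
    show "Units (w_structure (power_fun ` {0..}))
        = carrier (w_structure (power_fun ` {0..})) - {\<zero>\<^bsub>w_structure (power_fun ` {0..})\<^esub>}"
      using unit Units_closed by (auto simp: carrier zero eq_iff)
  qed (auto simp: carrier prod mult.commute)
qed

theorem proposition7p4:
  shows "(\<forall>S \<in> {param_funs, param_funs_cont0}.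
            semiring (w_structure S) \<and>
            (\<forall>l>0. flow l \<in> ring_iso (w_structure S) (w_structure S)) \<and>
            (\<forall>f\<in>S. flow 1 f = f) \<and>
            (\<forall>l>0. \<forall>m>0. \<forall>f\<in>S. flow (l * m) f = flow l (flow m f)))
       \<and> (\<forall>f\<in>param_funs.
            f \<in> flow_fixed param_funs \<longleftrightarrow>
            f 0 \<in> {0, 1} \<and> (\<exists>a\<ge>0. \<forall>T>0. f T = a powr T))
       \<and> flow_fixed param_funs_cont0 = power_fun ` {0..}
       \<and> semifield (w_structure (flow_fixed param_funs_cont0))
       \<and> power_fun \<in> ring_iso nonneg_reals (w_structure (flow_fixed param_funs_cont0))"
proof (intro conjI)
  have "semiring (w_structure S) \<and>
      (\<forall>l>0. flow l \<in> ring_iso (w_structure S) (w_structure S)) \<and>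
      (\<forall>f\<in>S. flow 1 f = f) \<and>
      (\<forall>l>0. \<forall>m>0. \<forall>f\<in>S. flow (l * m) f = flow l (flow m f))"
    if S: "w_subsemiring S" and closed: "\<And>l f. l > 0 \<Longrightarrow> f \<in> S \<Longrightarrow> flow l f \<in> S" for S
  proof -
    interpret w_subsemiring S by (rule S)
    show ?thesis
      by (simp add: semiring_w_structure flow_ring_iso closed in_param_funs flow_1)
        (simp add: flow_mult)
  qed
  from this[OF w_subsemiring_param_funs flow_in_param_funs]
    this[OF w_subsemiring_param_funs_cont0 flow_in_param_funs_cont0]
  show "\<forall>S \<in> {param_funs, param_funs_cont0}.
      semiring (w_structure S) \<and>
      (\<forall>l>0. flow l \<in> ring_iso (w_structure S) (w_structure S)) \<and>
      (\<forall>f\<in>S. flow 1 f = f) \<and>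
      (\<forall>l>0. \<forall>m>0. \<forall>f\<in>S. flow (l * m) f = flow l (flow m f))"
    by blast
  show "\<forall>f\<in>param_funs. f \<in> flow_fixed param_funs \<longleftrightarrow>
      f 0 \<in> {0, 1} \<and> (\<exists>a\<ge>0. \<forall>T>0. f T = a powr T)"
    using flow_fixed_iff by blast
  show "flow_fixed param_funs_cont0 = power_fun ` {0..}"
    by (rule flow_fixed_cont0_eq)
  show "semifield (w_structure (flow_fixed param_funs_cont0))"
    unfolding flow_fixed_cont0_eq by (rule semifield_power_fun)
  show "power_fun \<in> ring_iso nonneg_reals (w_structure (flow_fixed param_funs_cont0))"
    unfolding flow_fixed_cont0_eq by (rule power_fun_ring_iso)
qed

end
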